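(* Let $n \in \mathbb{N}$ (a positive integer) be divisible by $18$. Then there is an oriented graph $G$ on $n$ vertices with $\delta^0(G) = 7n/18 - 1$ which does not contain a perfect $T_3$-packing.
   Context: Digraphs have no loops and have at most one edge in each direction between any pair of vertices. An oriented graph is a digraph containing no 2-cycle, i.e. there is at most one directed edge between any pair of distinct vertices. For a digraph $G$, the minimum semidegree $\delta^0(G)$ is the minimum of its minimum outdegree $\delta^+(G)$ and its minimum indegree $\delta^-(G)$. $T_3$ denotes the transitive triangle, i.e. the transitive tournament on $3$ vertices. Given an oriented graph $H$, a perfect $H$-packing in an oriented graph $G$ is a collection of vertex-disjoint copies of $H$ in $G$ (as not necessarily induced subgraphs) which covers all the vertices of $G$. *)

theory Defs
  imports Complex_Main "Graph_Theory.Graph_Theory"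
begin

text \<open>
  The locale \<open>pair_digraph\<close> provides finite loopfree digraphs whose arcs are ordered
  pairs of vertices, so there is at most one arc in each direction between two vertices.
\<close>

locale oriented_graph = pair_digraph +
  assumes no_2_cycle: "(u, v) \<in> parcs G \<Longrightarrow> (v, u) \<notin> parcs G"

text \<open>The minimum degrees are only meaningful for finite digraphs with at least one vertex.\<close>

definition min_out_degree :: "('a, 'b) pre_digraph \<Rightarrow> nat" where
  "min_out_degree G = Min (out_degree G ` verts G)"

definition min_in_degree :: "('a, 'b) pre_digraph \<Rightarrow> nat" where
  "min_in_degree G = Min (in_degree G ` verts G)"

definition min_semidegree :: "('a, 'b) pre_digraph \<Rightarrow> nat" where
  "min_semidegree G = min (min_out_degree G) (min_in_degree G)"

definition transitive_tournament :: "nat \<Rightarrow> nat pair_pre_digraph" where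
  "transitive_tournament r = \<lparr> pverts = {..<r}, parcs = {(i, j). i < j \<and> j < r} \<rparr>"

text \<open>A copy of \<open>H\<close> in \<open>G\<close> is a (not necessarily induced) subgraph \<open>K\<close> of \<open>G\<close> isomorphic to \<open>H\<close>.\<close>

definition copy_in :: "'b pair_pre_digraph \<Rightarrow> 'a pair_pre_digraph \<Rightarrow> 'a pair_pre_digraph \<Rightarrow> bool" where
  "copy_in H G K \<longleftrightarrow>
     subgraph (with_proj K) (with_proj G) \<and> digraph_iso (with_proj H) (with_proj K)"

definition perfect_packing ::
    "'b pair_pre_digraph \<Rightarrow> 'a pair_pre_digraph \<Rightarrow> 'a pair_pre_digraph set \<Rightarrow> bool" where
  "perfect_packing H G \<P> \<longleftrightarrow>
     (\<forall>K\<in>\<P>. copy_in H G K) \<and>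
     pairwise (\<lambda>K L. disjnt (pverts K) (pverts L)) \<P> \<and>
     (\<Union>K\<in>\<P>. pverts K) = pverts G"

end

theory Submission
  imports Defs
begin

text \<open>
  Write \<open>n = 18k\<close> and split the vertices into \<open>A\<close> of size \<open>12k + 1\<close> and \<open>B\<close> of size \<open>6k - 1\<close>.
  Inside \<open>A\<close> take a balanced blow-up of the directed triangle, which contains no \<open>T\<^sub>3\<close>. Then every
  copy of \<open>T\<^sub>3\<close> meets \<open>B\<close>, so disjoint copies cover at most \<open>3(6k - 1) < n\<close> vertices. The arcs
  between \<open>A\<close> and \<open>B\<close> are oriented as evenly as possible, so a vertex of \<open>A\<close> has semidegree at
  least \<open>4k + (3k - 1) = 7k - 1\<close>; the vertices of \<open>B\<close> have room to spare.
\<close>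

section \<open>Copies of the transitive triangle and the vertices they cover\<close>

lemma copy_in_transitive_tournament_3E:
  assumes "copy_in (transitive_tournament 3) G K"
  obtains a b c where "pverts K = {a, b, c}"
    and "(a, b) \<in> parcs G" "(b, c) \<in> parcs G" "(a, c) \<in> parcs G"
proof -
  let ?T = "with_proj (transitive_tournament 3)"
  from assms have sub: "subgraph (with_proj K) (with_proj G)"
    and iso: "digraph_iso ?T (with_proj K)"
    by (auto simp: copy_in_def)
  from iso obtain f where f: "pre_digraph.digraph_isomorphism ?T f"
    and K: "with_proj K = app_iso f ?T"
    by (auto simp: digraph_iso_def)
  define h where "h = iso_verts f"
  have verts_T: "verts ?T = {0, 1, 2}"
    by (auto simp: transitive_tournament_def)
  have "verts (with_proj K) = h ` verts ?T"
    by (simp only: K verts_app_iso h_def)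
  hence verts_K: "pverts K = {h 0, h 1, h 2}"
    unfolding verts_T by simp
  \<comment> \<open>An isomorphism of pre-digraphs carries its own tail and head maps. As
    \<open>K\<close> is viewed through \<open>with_proj\<close>, they are the projections, so an
    image arc is the pair of its ends.\<close>
  have ends: "iso_tail f = fst" "iso_head f = snd"
    using arg_cong[OF K, of tail] arg_cong[OF K, of head] by simp_all
  have arc: "(h i, h j) \<in> parcs G" if "(i, j) \<in> arcs ?T" for i j
  proof -
    have "iso_arcs f (i, j) \<in> arcs (with_proj K)"
      unfolding K using that by simp
    moreover have "h i = fst (iso_arcs f (i, j))" "h j = snd (iso_arcs f (i, j))"
      using f that ends by (auto simp: pre_digraph.digraph_isomorphism_def h_def)
    ultimately show ?thesis
      using sub by (auto simp: subgraph_def)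
  qed
  show ?thesis
    by (rule that[OF verts_K]; rule arc) (auto simp: transitive_tournament_def)
qed

text \<open>Choosing a vertex of \<open>B\<close> in each copy is injective by disjointness, so
  there are at most \<open>card B\<close> copies, with at most three vertices each.\<close>

lemma card_le_if_perfect_packing_transitive_tournament_3:
  assumes packing: "perfect_packing (transitive_tournament 3) G \<P>" and "finite B"
    and meets: "\<And>a b c. (a, b) \<in> parcs G \<Longrightarrow> (b, c) \<in> parcs G \<Longrightarrow> (a, c) \<in> parcs G \<Longrightarrow>
      {a, b, c} \<inter> B \<noteq> {}"
  shows "card (pverts G) \<le> 3 * card B"
proof -
  have copy: "copy_in (transitive_tournament 3) G K" if "K \<in> \<P>" for K
    using packing that by (simp add: perfect_packing_def)
  have "\<exists>v. v \<in> pverts K \<inter> B" if "K \<in> \<P>" for K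
    using copy[OF that] meets by (metis copy_in_transitive_tournament_3E ex_in_conv)
  then obtain g where g: "\<And>K. K \<in> \<P> \<Longrightarrow> g K \<in> pverts K \<inter> B"
    by metis
  have inj: "inj_on g \<P>"
  proof (rule inj_onI, rule ccontr)
    fix K L
    assume KL: "K \<in> \<P>" "L \<in> \<P>" "g K = g L" "K \<noteq> L"
    with packing have "disjnt (pverts K) (pverts L)"
      by (auto simp: perfect_packing_def pairwise_def)
    with g[OF KL(1)] g[OF KL(2)] KL(3) show False
      by (auto simp: disjnt_def)
  qed
  have img: "g ` \<P> \<subseteq> B"
    using g by auto
  \<comment> \<open>The union bound requires a finite packing; finiteness is inherited from
    \<open>B\<close>.\<close>
  have fin: "finite \<P>"
    using inj_on_finite[OF inj img \<open>finite B\<close>] .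
  have "card (pverts G) = card (\<Union>K\<in>\<P>. pverts K)"
    using packing by (simp add: perfect_packing_def)
  also have "\<dots> \<le> (\<Sum>K\<in>\<P>. card (pverts K))"
    by (rule card_UN_le[OF fin])
  also have "\<dots> \<le> (\<Sum>K\<in>\<P>. 3)"
  proof (rule sum_mono)
    fix K assume "K \<in> \<P>"
    from copy[OF this] obtain a b c where "pverts K = {a, b, c}"
      by (rule copy_in_transitive_tournament_3E)
    thus "card (pverts K) \<le> 3"
      using card_length[of "[a, b, c]"] by simp
  qed
  also have "\<dots> \<le> 3 * card B"
    using card_inj_on_le[OF inj img \<open>finite B\<close>] by simp
  finally show ?thesis .
qed

section \<open>Counting in residue classes\<close>

text \<open>The interval splits into \<open>b - a\<close> full blocks of length \<open>q\<close>,
  each with exactly one number of residue \<open>r\<close>.\<close>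

lemma card_residue_class:
  fixes q r a b :: nat
  assumes "r < q"
  shows "card {v \<in> {q * a..<q * b}. v mod q = r} = b - a"
proof -
  have "{v \<in> {q * a..<q * b}. v mod q = r} = (\<lambda>i. q * i + r) ` {a..<b}"
  proof (intro equalityI subsetI)
    fix v assume v: "v \<in> {v \<in> {q * a..<q * b}. v mod q = r}"
    hence "v = q * (v div q) + r"
      by (metis (mono_tags, lifting) mem_Collect_eq mult_div_mod_eq)
    moreover have "a \<le> v div q" "v div q < b"
      using v assms by (auto simp: less_eq_div_iff_mult_less_eq div_less_iff_less_mult mult.commute)
    ultimately show "v \<in> (\<lambda>i. q * i + r) ` {a..<b}"
      using image_eqI[of v "\<lambda>i. q * i + r" "v div q" "{a..<b}"] by (simp only: atLeastLessThan_iff)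
  next
    fix v assume "v \<in> (\<lambda>i. q * i + r) ` {a..<b}"
    then obtain i where i: "i \<in> {a..<b}" and v: "v = q * i + r"
      by (rule imageE)
    from i have "q * a \<le> q * i" "q * Suc i \<le> q * b"
      by (auto intro!: mult_le_mono2 simp only: atLeastLessThan_iff Suc_le_eq)
    hence "q * a \<le> v" "v < q * b"
      using assms unfolding v mult_Suc_right by linarith+
    moreover have "v mod q = r"
      using assms by (simp add: v)
    ultimately show "v \<in> {v \<in> {q * a..<q * b}. v mod q = r}"
      by (simp only: mem_Collect_eq atLeastLessThan_iff)
  qed
  moreover have "inj_on (\<lambda>i. q * i + r) {a..<b}"
    using assms by (auto simp: inj_on_def)
  ultimately show ?thesis
    by (simp add: card_image)
qed

text \<open>Made for neighbourhoods that combine a class modulo 3 in one part with a parity class in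
  the other. The counts add up because the first interval ends no later than the second
  begins.\<close>

lemma card_ge_two_residue_classes:
  fixes N :: nat
  assumes "r < q" "r' < q'" "q * b \<le> q' * a'" "q * b \<le> N" "q' * b' \<le> N"
    and "\<And>v. q * a \<le> v \<Longrightarrow> v < q * b \<Longrightarrow> v mod q = r \<Longrightarrow> P v"
    and "\<And>v. q' * a' \<le> v \<Longrightarrow> v < q' * b' \<Longrightarrow> v mod q' = r' \<Longrightarrow> P v"
  shows "(b - a) + (b' - a') \<le> card {v. v < N \<and> P v}"
proof -
  let ?X = "{v \<in> {q * a..<q * b}. v mod q = r}"
  let ?Y = "{v \<in> {q' * a'..<q' * b'}. v mod q' = r'}"
  have "card (?X \<union> ?Y) = (b - a) + (b' - a')"
  proof (subst card_Un_disjoint)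
    show "?X \<inter> ?Y = {}"
      using assms(3) by auto
  qed (simp_all only: card_residue_class assms(1,2) finite_Collect_conjI finite_atLeastLessThan
      Collect_mem_eq simp_thms)
  moreover have "card (?X \<union> ?Y) \<le> card {v. v < N \<and> P v}"
    using assms(4-) by (intro card_mono) auto
  ultimately show ?thesis by simp
qed

lemma out_degree_with_proj:
  "out_degree (with_proj G) u = card {v. (u, v) \<in> parcs G}"
proof -
  have "out_arcs (with_proj G) u = Pair u ` {v. (u, v) \<in> parcs G}"
    by (auto simp: out_arcs_def)
  thus ?thesis
    by (simp add: out_degree_def card_image inj_on_def)
qed

lemma in_degree_with_proj:
  "in_degree (with_proj G) u = card {v. (v, u) \<in> parcs G}"
proof -
  have "in_arcs (with_proj G) u = (\<lambda>v. (v, u)) ` {v. (v, u) \<in> parcs G}"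
    by (auto simp: in_arcs_def)
  thus ?thesis
    by (simp add: in_degree_def card_image inj_on_def)
qed

text \<open>
  The vertices up to \<open>12k\<close> form \<open>A\<close>, the others \<open>B\<close>. The parity rule between the parts is balanced
  for \<open>A\<close> because \<open>B\<close> contains \<open>3k - 1\<close> even and \<open>3k\<close> odd numbers; \<open>B\<close> also carries a blow-up of
  the directed triangle, merely to supply degree.
\<close>

definition extremal_arc :: "nat \<Rightarrow> nat \<Rightarrow> nat \<Rightarrow> bool" where
  "extremal_arc k u v \<longleftrightarrow>
     (if u \<le> 12 * k \<longleftrightarrow> v \<le> 12 * k then v mod 3 = Suc u mod 3 else even (u + v) = (u \<le> 12 * k))"

definition extremal_graph :: "nat \<Rightarrow> nat pair_pre_digraph" where
  "extremal_graph k =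
     \<lparr> pverts = {..<18 * k}, parcs = {(u, v). u < 18 * k \<and> v < 18 * k \<and> extremal_arc k u v} \<rparr>"

lemma Suc_mod_3_neq: "Suc b mod 3 \<noteq> b mod 3" "Suc (Suc b) mod 3 \<noteq> b mod 3"
  by (simp_all add: mod_Suc)

text \<open>Inside a part, arcs both ways would give \<open>u\<close> and \<open>u + 2\<close> the
  same residue modulo 3. Across the parts, the parity of \<open>u + v\<close> would have to match
  two opposite truth values.\<close>

lemma extremal_arc_asym: "extremal_arc k u v \<Longrightarrow> \<not> extremal_arc k v u"
  by (cases "u \<le> 12 * k \<longleftrightarrow> v \<le> 12 * k")
    (metis extremal_arc_def Suc_mod_3_neq(2) mod_Suc_eq, auto simp: extremal_arc_def add.commute)

lemma extremal_arc_irrefl: "\<not> extremal_arc k u u"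
  using extremal_arc_asym by blast

lemma oriented_graph_extremal_graph: "oriented_graph (extremal_graph k)"
proof unfold_locales
  show "finite (parcs (extremal_graph k))"
    by (rule finite_subset[of _ "{..<18 * k} \<times> {..<18 * k}"]) (auto simp: extremal_graph_def)
qed (auto simp: extremal_graph_def extremal_arc_irrefl dest: extremal_arc_asym)

section \<open>Semidegree of the extremal graph\<close>

lemma extremal_degree_ge:
  assumes "k > 0" "u < 18 * k"
  shows "7 * k - 1 \<le> card {v. v < 18 * k \<and> extremal_arc k u v}" (is "_ \<le> card ?Out")
    and "7 * k - 1 \<le> card {v. v < 18 * k \<and> extremal_arc k v u}" (is "_ \<le> card ?In")
proof -
  \<comment> \<open>In-neighbours inside a part have to be described by a residue of
    \<open>v\<close>, and the predecessor of \<open>u\<close> modulo 3 is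
    \<open>u + 2\<close>.\<close>
  have pred: "u mod 3 = Suc v mod 3" if "v mod 3 = (u + 2) mod 3" for v
  proof -
    have "(v + 1) mod 3 = (u + 2 + 1) mod 3"
      by (rule mod_add_cong[OF that refl])
    also have "u + 2 + 1 = u + 3"
      by linarith
    finally show ?thesis
      by (simp only: mod_add_self2 Suc_eq_plus1)
  qed
  have parity: "even (u + v)" if "v mod 2 = u mod 2" for v
    using that by presburger
  have parity': "odd (u + v)" if "v mod 2 = Suc u mod 2" for v
    using that by presburger
  have "7 * k - 1 \<le> card ?Out \<and> 7 * k - 1 \<le> card ?In"
  proof (cases "u \<le> 12 * k")
    case True
    \<comment> \<open>Intervals are trimmed to multiples of the modulus: \<open>4 * k\<close>
      neighbours below \<open>12 * k\<close> and \<open>3 * k - 1\<close> from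
      \<open>12 * k + 2\<close> on.\<close>
    have "(4 * k - 0) + (9 * k - (6 * k + 1)) \<le> card ?Out"
    proof (rule card_ge_two_residue_classes[where q = 3 and r = "Suc u mod 3"
          and q' = 2 and r' = "u mod 2"])
      fix v :: nat
      assume "v < 3 * (4 * k)" "v mod 3 = Suc u mod 3"
      thus "extremal_arc k u v"
        using True by (simp add: extremal_arc_def)
    next
      fix v :: nat
      assume "2 * (6 * k + 1) \<le> v" "v mod 2 = u mod 2"
      from this(1) parity[OF this(2)] show "extremal_arc k u v"
        using True by (simp add: extremal_arc_def add.commute)
    qed (use assms in simp_all)
    moreover have "(4 * k - 0) + (9 * k - (6 * k + 1)) \<le> card ?In"
    proof (rule card_ge_two_residue_classes[where q = 3 and r = "(u + 2) mod 3"
          and q' = 2 and r' = "Suc u mod 2"])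
      fix v :: nat
      assume "v < 3 * (4 * k)" "v mod 3 = (u + 2) mod 3"
      from this(1) pred[OF this(2)] show "extremal_arc k v u"
        using True by (simp add: extremal_arc_def)
    next
      fix v :: nat
      assume "2 * (6 * k + 1) \<le> v" "v mod 2 = Suc u mod 2"
      from this(1) parity'[OF this(2)] show "extremal_arc k v u"
        using True by (simp add: extremal_arc_def add.commute)
    qed (use assms in simp_all)
    ultimately show ?thesis
      using assms by simp
  next
    case False
    \<comment> \<open>For a vertex of \<open>B\<close> the trimmed intervals give
      \<open>6 * k\<close> neighbours in \<open>A\<close> and \<open>2 * k - 1\<close> in
      \<open>B\<close>, hence \<open>8 * k - 1\<close>.\<close>
    have "(6 * k - 0) + (6 * k - (4 * k + 1)) \<le> card ?Out"
    proof (rule card_ge_two_residue_classes[where q = 2 and r = "Suc u mod 2"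
          and q' = 3 and r' = "Suc u mod 3"])
      fix v :: nat
      assume "v < 2 * (6 * k)" "v mod 2 = Suc u mod 2"
      from this(1) parity'[OF this(2)] show "extremal_arc k u v"
        using False by (simp add: extremal_arc_def add.commute)
    next
      fix v :: nat
      assume "3 * (4 * k + 1) \<le> v" "v mod 3 = Suc u mod 3"
      thus "extremal_arc k u v"
        using False by (simp add: extremal_arc_def)
    qed (use assms in simp_all)
    moreover have "(6 * k - 0) + (6 * k - (4 * k + 1)) \<le> card ?In"
    proof (rule card_ge_two_residue_classes[where q = 2 and r = "u mod 2"
          and q' = 3 and r' = "(u + 2) mod 3"])
      fix v :: nat
      assume "v < 2 * (6 * k)" "v mod 2 = u mod 2"
      from this(1) parity[OF this(2)] show "extremal_arc k v u"
        using False by (simp add: extremal_arc_def add.commute)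
    next
      fix v :: nat
      assume "3 * (4 * k + 1) \<le> v" "v mod 3 = (u + 2) mod 3"
      from this(1) pred[OF this(2)] show "extremal_arc k v u"
        using False by (simp add: extremal_arc_def)
    qed (use assms in simp_all)
    ultimately show ?thesis
      by linarith
  qed
  thus "7 * k - 1 \<le> card ?Out" "7 * k - 1 \<le> card ?In"
    by auto
qed

text \<open>Shows that the lower bound is attained: for the vertex 0, trimming the intervals loses
  no out-neighbour.\<close>

lemma extremal_out_degree_0:
  assumes "k > 0"
  shows "card {v. v < 18 * k \<and> extremal_arc k 0 v} = 7 * k - 1"
proof (rule antisym)
  let ?X = "{v \<in> {3 * 0..<3 * (4 * k)}. v mod 3 = 1}"
  let ?Y = "{v \<in> {2 * (6 * k + 1)..<2 * (9 * k)}. v mod 2 = 0}"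
  have "v \<in> ?X \<union> ?Y" if v: "v < 18 * k" "extremal_arc k 0 v" for v
  proof (cases "v \<le> 12 * k")
    case True
    with v(2) have mod: "v mod 3 = 1"
      by (simp add: extremal_arc_def)
    \<comment> \<open>The trimmed vertex of \<open>A\<close> is 0 modulo 3.\<close>
    hence "v \<noteq> 12 * k"
      by auto
    with True have "v < 3 * (4 * k)"
      by arith
    with mod show ?thesis
      by simp
  next
    case False
    with v(2) have "even v"
      by (simp add: extremal_arc_def)
    \<comment> \<open>The trimmed vertex of \<open>B\<close> is odd.\<close>
    moreover from this have "v \<noteq> 12 * k + 1"
      by auto
    with False have "2 * (6 * k + 1) \<le> v"
      by arith
    ultimately show ?thesis
      using v(1) by (simp add: even_iff_mod_2_eq_zero)
  qed
  hence "card {v. v < 18 * k \<and> extremal_arc k 0 v} \<le> card (?X \<union> ?Y)"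
    by (intro card_mono finite_UnI finite_Collect_conjI disjI1 finite_atLeastLessThan subsetI)
      (simp_all only: mem_Collect_eq Collect_mem_eq finite_atLeastLessThan)
  also have "\<dots> \<le> card ?X + card ?Y"
    by (rule card_Un_le)
  also have "\<dots> = (4 * k - 0) + (9 * k - (6 * k + 1))"
    by (subst (1 2) card_residue_class) simp_all
  finally show "card {v. v < 18 * k \<and> extremal_arc k 0 v} \<le> 7 * k - 1"
    using assms by linarith
  show "7 * k - 1 \<le> card {v. v < 18 * k \<and> extremal_arc k 0 v}"
    using assms by (intro extremal_degree_ge) simp_all
qed

lemma min_semidegree_extremal_graph:
  assumes "k > 0"
  shows "min_semidegree (with_proj (extremal_graph k)) = 7 * k - 1"
proof -
  let ?G = "with_proj (extremal_graph k)"
  have verts: "verts ?G = {..<18 * k}"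
    by (simp add: extremal_graph_def)
  have out: "out_degree ?G u = card {v. v < 18 * k \<and> extremal_arc k u v}" if "u < 18 * k" for u
    using that by (simp add: out_degree_with_proj extremal_graph_def)
  have inn: "in_degree ?G u = card {v. v < 18 * k \<and> extremal_arc k v u}" if "u < 18 * k" for u
    using that by (simp add: in_degree_with_proj extremal_graph_def)
  have "out_degree ?G 0 = 7 * k - 1"
    using assms by (simp add: out extremal_out_degree_0)
  hence "min_out_degree ?G = 7 * k - 1"
    unfolding min_out_degree_def verts using assms
    by (intro Min_eqI) (auto simp: out extremal_degree_ge simp del: One_nat_def intro!: image_eqI[of _ _ 0])
  \<comment> \<open>A lower bound suffices, since the minimum out-degree already attains the
    value.\<close>
  moreover have "7 * k - 1 \<le> min_in_degree ?G"
    unfolding min_in_degree_def verts using assms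
    by (intro Min.boundedI) (auto simp: inn extremal_degree_ge lessThan_empty_iff simp del: One_nat_def)
  ultimately show ?thesis
    by (simp add: min_semidegree_def)
qed

section \<open>Absence of a perfect packing\<close>

text \<open>Each arc inside \<open>A\<close> raises the residue modulo 3 by one, so the path through
  \<open>b\<close> raises it by two and the arc from \<open>a\<close> to \<open>c\<close> by
  one.\<close>

lemma extremal_arc_no_transitive_triangle:
  assumes "extremal_arc k a b" "extremal_arc k b c" "extremal_arc k a c"
  shows "\<not> (a \<le> 12 * k \<and> b \<le> 12 * k \<and> c \<le> 12 * k)"
proof
  assume "a \<le> 12 * k \<and> b \<le> 12 * k \<and> c \<le> 12 * k"
  hence "b mod 3 = Suc a mod 3" "c mod 3 = Suc b mod 3" "c mod 3 = Suc a mod 3"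
    using assms by (auto simp: extremal_arc_def)
  thus False
    by (metis Suc_mod_3_neq(1))
qed

lemma no_perfect_packing_extremal_graph:
  assumes "k > 0"
  shows "\<not> perfect_packing (transitive_tournament 3) (extremal_graph k) \<P>"
proof
  let ?B = "{12 * k<..<18 * k}"
  assume "perfect_packing (transitive_tournament 3) (extremal_graph k) \<P>"
  hence "card (pverts (extremal_graph k)) \<le> 3 * card ?B"
  proof (rule card_le_if_perfect_packing_transitive_tournament_3)
    fix a b c
    assume "(a, b) \<in> parcs (extremal_graph k)" "(b, c) \<in> parcs (extremal_graph k)"
      "(a, c) \<in> parcs (extremal_graph k)"
    thus "{a, b, c} \<inter> ?B \<noteq> {}"
      using extremal_arc_no_transitive_triangle[of k a b c] by (auto simp: extremal_graph_def)
  qed simp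
  \<comment> \<open>\<open>?B\<close> has \<open>6 * k - 1\<close> elements, so the bound would read
    \<open>18 * k\<close> \<le> \<open>18 * k - 3\<close>.\<close>
  thus False
    using assms by (simp add: extremal_graph_def)
qed

theorem proposition6:
  fixes n :: nat
  assumes "n > 0" and "18 dvd n"
  shows "\<exists>G :: nat pair_pre_digraph.
           oriented_graph G \<and>
           card (pverts G) = n \<and>
           real (min_semidegree (with_proj G)) = 7 * real n / 18 - 1 \<and>
           \<not> (\<exists>\<P>. perfect_packing (transitive_tournament 3) G \<P>)"
proof -
  from \<open>18 dvd n\<close> obtain k where n: "n = 18 * k" ..
  with \<open>n > 0\<close> have k: "k > 0"
    by simp
  show ?thesis
  proof (intro exI conjI)
    show "oriented_graph (extremal_graph k)"
      by (rule oriented_graph_extremal_graph)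
    show "card (pverts (extremal_graph k)) = n"
      by (simp add: extremal_graph_def n)
    show "real (min_semidegree (with_proj (extremal_graph k))) = 7 * real n / 18 - 1"
      using k by (simp add: min_semidegree_extremal_graph n of_nat_diff)
    show "\<not> (\<exists>\<P>. perfect_packing (transitive_tournament 3) (extremal_graph k) \<P>)"
      using no_perfect_packing_extremal_graph[OF k] by blast
  qed
qed

end
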